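(* Let $A\in\mathbb{R}^{m\times n}$, $b\in\mathbb{R}^m$ and $\ell,u\in\mathbb{R}^n$ with $\ell\le0\le u$, and consider the ResQPASS iteration described in the context. In the unconstrained case, where at every iteration $k$ none of the bounds in the projected problem $\min_{y\in\mathbb{R}^k}\frac12\|AV_ky-b\|_2^2$ s.t. $\ell\le V_ky\le u$ is active at its solution, one has for every iteration $k$ $$\mathrm{span}\{r_0,r_1,\ldots,r_k\}=\mathcal{K}_{k+1}(A^TA,r_0):=\mathrm{span}\{r_0,A^TAr_0,\ldots,(A^TA)^kr_0\}.$$
   Context: ResQPASS iteration: inequalities between vectors are componentwise. Start with $x_0=0$, $\lambda_0=\mu_0=0$, $r_0=-A^Tb$. For $k\ge1$ let $V_k\in\mathbb{R}^{n\times k}$ be the matrix with columns $v_j=r_{j-1}/\|r_{j-1}\|_2$, $j=1,\dots,k$ (iterations are considered only as long as the residuals $r_0,\dots,r_{k-1}$ are nonzero, so that $V_k$ is defined). Let $x_k=V_ky_k$ where $y_k\in\mathbb{R}^k$ solves $\min_{y}\frac12\|AV_ky-b\|_2^2$ s.t. $\ell\le V_ky\le u$, and let $\lambda_k,\mu_k\in\mathbb{R}^n$ be associated Lagrange multipliers of the lower and upper bounds, i.e. the KKT conditions hold: $V_k^TA^T(AV_ky_k-b)-V_k^T\lambda_k+V_k^T\mu_k=0$; $(\lambda_k)_i([V_ky_k]_i-\ell_i)=0$ and $(\mu_k)_i(u_i-[V_ky_k]_i)=0$ for all $i$; $\ell\le V_ky_k\le u$; $\lambda_k,\mu_k\ge0$.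 Then set $r_k=A^T(Ax_k-b)-\lambda_k+\mu_k$. A bound is active at iteration $k$ if $[V_ky_k]_i=\ell_i$ or $[V_ky_k]_i=u_i$ for some index $i$. *)

theory Defs
  imports "HOL-Analysis.Analysis"
begin

text \<open>
  The number \<open>k\<close> of columns of \<open>V\<^sub>k\<close> varies along the iteration, so an \<open>n \<times> k\<close> matrix is represented
  by the family \<open>v 1, \<dots>, v k\<close> of its columns and a vector of \<open>\<real>\<^sup>k\<close> by a function on \<open>nat\<close> of which
  only the values at \<open>1, \<dots>, k\<close> are used. The norm of \<^typ>\<open>real ^ 'n\<close> is the 2-norm, and its order
  \<open>\<le>\<close> is componentwise.
\<close>

definition cols_mult :: "nat \<Rightarrow> (nat \<Rightarrow> real ^ 'n) \<Rightarrow> (nat \<Rightarrow> real) \<Rightarrow> real ^ 'n" where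
  "cols_mult k v y = (\<Sum>j = 1..k. y j *\<^sub>R v j)"

text \<open>Component \<open>j\<close> of the product of the transpose with \<open>w\<close>; meaningful for \<open>1 \<le> j \<le> k\<close>.\<close>

definition cols_transpose_mult :: "(nat \<Rightarrow> real ^ 'n) \<Rightarrow> real ^ 'n \<Rightarrow> nat \<Rightarrow> real" where
  "cols_transpose_mult v w j = v j \<bullet> w"

definition basis_col :: "(nat \<Rightarrow> real ^ 'n) \<Rightarrow> nat \<Rightarrow> real ^ 'n" where
  "basis_col r j = r (j - 1) /\<^sub>R norm (r (j - 1))"

definition solves_projected ::
  "real ^ 'n ^ 'm \<Rightarrow> real ^ 'm \<Rightarrow> real ^ 'n \<Rightarrow> real ^ 'n \<Rightarrow> nat \<Rightarrow> (nat \<Rightarrow> real ^ 'n)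
    \<Rightarrow> (nat \<Rightarrow> real) \<Rightarrow> bool" where
  "solves_projected A b l u k v y \<longleftrightarrow>
     is_arg_min (\<lambda>z. 1 / 2 * (norm (A *v cols_mult k v z - b))\<^sup>2)
       (\<lambda>z. l \<le> cols_mult k v z \<and> cols_mult k v z \<le> u) y"

definition projected_KKT ::
  "real ^ 'n ^ 'm \<Rightarrow> real ^ 'm \<Rightarrow> real ^ 'n \<Rightarrow> real ^ 'n \<Rightarrow> nat \<Rightarrow> (nat \<Rightarrow> real ^ 'n)
    \<Rightarrow> (nat \<Rightarrow> real) \<Rightarrow> real ^ 'n \<Rightarrow> real ^ 'n \<Rightarrow> bool" where
  "projected_KKT A b l u k v y lam mu \<longleftrightarrow>
     (\<forall>j\<in>{1..k}. cols_transpose_mult v (transpose A *v (A *v cols_mult k v y - b)) j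
                  - cols_transpose_mult v lam j + cols_transpose_mult v mu j = 0) \<and>
     (\<forall>i. lam $ i * (cols_mult k v y $ i - l $ i) = 0) \<and>
     (\<forall>i. mu $ i * (u $ i - cols_mult k v y $ i) = 0) \<and>
     l \<le> cols_mult k v y \<and> cols_mult k v y \<le> u \<and>
     0 \<le> lam \<and> 0 \<le> mu"

text \<open>
  Iteration \<open>k\<close> takes place only if the earlier residuals are nonzero, so that \<open>V\<^sub>k\<close> is defined.
  After a breakdown the sequences continue with arbitrary values.
\<close>

definition iteration_defined :: "(nat \<Rightarrow> real ^ 'n) \<Rightarrow> nat \<Rightarrow> bool" where
  "iteration_defined r k \<longleftrightarrow> (\<forall>j<k. r j \<noteq> 0)"

definition resqpass ::
  "real ^ 'n ^ 'm \<Rightarrow> real ^ 'm \<Rightarrow> real ^ 'n \<Rightarrow> real ^ 'n \<Rightarrow> (nat \<Rightarrow> real ^ 'n) \<Rightarrow> (nat \<Rightarrow> nat \<Rightarrow> real)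
    \<Rightarrow> (nat \<Rightarrow> real ^ 'n) \<Rightarrow> (nat \<Rightarrow> real ^ 'n) \<Rightarrow> (nat \<Rightarrow> real ^ 'n) \<Rightarrow> bool" where
  "resqpass A b l u x y lam mu r \<longleftrightarrow>
     x 0 = 0 \<and> lam 0 = 0 \<and> mu 0 = 0 \<and> r 0 = - (transpose A *v b) \<and>
     (\<forall>k\<ge>1. iteration_defined r k \<longrightarrow>
        solves_projected A b l u k (basis_col r) (y k) \<and>
        projected_KKT A b l u k (basis_col r) (y k) (lam k) (mu k) \<and>
        x k = cols_mult k (basis_col r) (y k) \<and>
        r k = transpose A *v (A *v x k - b) - lam k + mu k)"

definition bound_active ::
  "real ^ 'n \<Rightarrow> real ^ 'n \<Rightarrow> nat \<Rightarrow> (nat \<Rightarrow> real ^ 'n) \<Rightarrow> (nat \<Rightarrow> real) \<Rightarrow> bool" where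
  "bound_active l u k v y \<longleftrightarrow>
     (\<exists>i. cols_mult k v y $ i = l $ i \<or> cols_mult k v y $ i = u $ i)"

text \<open>
  Powers of \<open>M\<close> are iterates of the map \<open>w \<mapsto> M w\<close>: the multiplication that the type class structure
  puts on \<^typ>\<open>real ^ 'n ^ 'n\<close> is componentwise, so \<open>M ^ j\<close> would not be the matrix power.
\<close>

definition krylov :: "nat \<Rightarrow> real ^ 'n ^ 'n \<Rightarrow> real ^ 'n \<Rightarrow> (real ^ 'n) set" where
  "krylov d M w = span ((\<lambda>j. ((*v) M ^^ j) w) ` {..<d})"

end

theory Submission
  imports Defs
begin

text \<open>
  Write \<open>M = A\<^sup>T A\<close>. If no bound is active, complementarity makes both multipliers vanish, so the
  iteration is a Galerkin method: \<open>r\<^sub>k = M x\<^sub>k + r\<^sub>0\<close> with \<open>x\<^sub>k\<close> in the span of the earlier residuals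
  (\<open>resqpass_inactive_residual_form\<close>), and stationarity of the projected problem says that \<open>r\<^sub>k\<close> is
  orthogonal to them (\<open>resqpass_inactive_residual_orthogonal\<close>).

  These two properties alone force the Krylov identity (\<open>span_orthogonal_residuals_eq_krylov\<close>).
  The form of \<open>r\<^sub>k\<close> gives \<open>span {r\<^sub>0, \<dots>, r\<^sub>k} \<subseteq> K\<^bsub>k+1\<^esub>\<close> by induction, and equality follows by counting
  dimensions. The nonzero residuals are pairwise orthogonal, hence independent. If
  \<open>r\<^sub>k \<noteq> 0\<close>, the left side therefore has dimension \<open>k + 1\<close>, the largest that \<open>K\<^bsub>k+1\<^esub>\<close> can have.
  If \<open>r\<^sub>k = 0\<close>, which is how the iteration ends, the left side has only dimension \<open>k\<close>; but
  then \<open>r\<^sub>0 = - M x\<^sub>k\<close> lies in \<open>M K\<^sub>k\<close>, so that \<open>K\<^bsub>k+1\<^esub> = M K\<^sub>k\<close> has dimension at most \<open>k\<close>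
  as well.
\<close>

section \<open>Krylov spaces\<close>

lemma subspace_krylov: "subspace (krylov d M w)"
  unfolding krylov_def by (rule subspace_span)

lemma dim_krylov_le:
  fixes M :: "real ^ 'n ^ 'n"
  shows "dim (krylov d M w) \<le> d"
proof -
  have "dim (krylov d M w) \<le> card ((\<lambda>j. ((*v) M ^^ j) w) ` {..<d})"
    unfolding krylov_def dim_span by (rule dim_le_card') simp
  also have "\<dots> \<le> d"
    using card_image_le[of "{..<d}" "\<lambda>j. ((*v) M ^^ j) w"] by simp
  finally show ?thesis .
qed

lemma krylov_Suc:
  fixes M :: "real ^ 'n ^ 'n"
  shows "krylov (Suc d) M w = span (insert w ((*v) M ` krylov d M w))"
proof -
  have "(\<lambda>j. ((*v) M ^^ j) w) ` {..<Suc d} = insert w ((*v) M ` (\<lambda>j. ((*v) M ^^ j) w) ` {..<d})"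
    unfolding lessThan_Suc_eq_insert_0 by (simp add: image_image)
  moreover have "(*v) M ` krylov d M w = span ((*v) M ` (\<lambda>j. ((*v) M ^^ j) w) ` {..<d})"
    unfolding krylov_def by (rule linear_span_image[symmetric]) simp
  ultimately show ?thesis
    unfolding krylov_def[of "Suc d"] by (simp add: span_insert span_span)
qed

lemma krylov_mono: "d \<le> e \<Longrightarrow> krylov d M w \<subseteq> krylov e M w"
  unfolding krylov_def by (intro span_mono image_mono) auto

section \<open>Orthogonal residuals span Krylov spaces\<close>

lemma dim_orthogonal_family:
  fixes r :: "nat \<Rightarrow> 'a :: euclidean_space"
  assumes orth: "\<And>i j. i < j \<Longrightarrow> j < d \<Longrightarrow> r i \<bullet> r j = 0"
    and nz: "\<And>j. j < d \<Longrightarrow> r j \<noteq> 0"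
  shows "dim (r ` {..<d}) = d"
proof -
  have orth': "r i \<bullet> r j = 0" if "i < d" "j < d" "i \<noteq> j" for i j
    using that orth[of i j] orth[of j i] by (cases "i < j") (auto simp: inner_commute)
  have "inj_on r {..<d}"
  proof (rule inj_onI, rule ccontr)
    fix i j assume "i \<in> {..<d}" "j \<in> {..<d}" "r i = r j" "i \<noteq> j"
    then show False
      using orth'[of i j] nz[of j] by simp
  qed
  moreover have "independent (r ` {..<d})"
  proof (rule pairwise_orthogonal_independent)
    show "pairwise orthogonal (r ` {..<d})"
      unfolding pairwise_image by (auto simp: pairwise_def orthogonal_def orth')
    show "0 \<notin> r ` {..<d}"
      using nz by fastforce
  qed
  ultimately show ?thesis
    by (simp add: dim_eq_card_independent card_image)
qed

text \<open>
  The inclusion of the residuals in the Krylov space needs only their form; orthogonality makes them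
  independent, so that it can be turned into an equality by comparing dimensions.
\<close>

lemma span_orthogonal_residuals_eq_krylov:
  fixes M :: "real ^ 'n ^ 'n" and r :: "nat \<Rightarrow> real ^ 'n"
  assumes form: "\<And>k. k \<ge> 1 \<Longrightarrow> iteration_defined r k \<Longrightarrow>
      \<exists>x \<in> span (r ` {..<k}). r k = M *v x + r 0"
    and orth: "\<And>i k. i < k \<Longrightarrow> iteration_defined r k \<Longrightarrow> r i \<bullet> r k = 0"
    and "iteration_defined r k"
  shows "span (r ` {..k}) = krylov (Suc k) M (r 0)"
  using \<open>iteration_defined r k\<close>
proof (induction k)
  case 0
  show ?case by (simp add: krylov_def lessThan_Suc)
next
  case (Suc k)
  define K where "K = (\<lambda>d. krylov d M (r 0))"
  have nz: "r j \<noteq> 0" if "j \<le> k" for j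
    using Suc.prems that unfolding iteration_defined_def by simp
  have "iteration_defined r k"
    using nz unfolding iteration_defined_def by simp
  then have IH: "span (r ` {..k}) = K (Suc k)"
    unfolding K_def by (rule Suc.IH)
  obtain x where x: "x \<in> K (Suc k)" and rx: "r (Suc k) = M *v x + r 0"
    using form[of "Suc k"] Suc.prems IH by (auto simp: lessThan_Suc_atMost)
  have orth': "r i \<bullet> r j = 0" if "i < j" "j \<le> Suc k" for i j
    by (rule orth) (use that nz in \<open>auto simp: iteration_defined_def\<close>)

  have sub: "span (r ` {..Suc k}) \<subseteq> K (Suc (Suc k))"
  proof (rule span_minimal)
    have "r (Suc k) \<in> K (Suc (Suc k))"
      unfolding rx K_def krylov_Suc[of "Suc k"]
      using x by (intro span_add span_base) (auto simp: K_def)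
    moreover have "r ` {..k} \<subseteq> K (Suc (Suc k))"
      using span_superset[of "r ` {..k}"] krylov_mono[of "Suc k" "Suc (Suc k)" M "r 0"]
      unfolding IH unfolding K_def by auto
    ultimately show "r ` {..Suc k} \<subseteq> K (Suc (Suc k))"
      by (simp add: atMost_Suc)
  qed (simp add: K_def subspace_krylov)

  have dims: "dim (K (Suc (Suc k))) \<le> dim (r ` {..Suc k})"
  proof (cases "r (Suc k) = 0")
    case False
    have "dim (r ` {..<Suc (Suc k)}) = Suc (Suc k)"
      by (rule dim_orthogonal_family) (use orth' nz False in \<open>auto simp: less_Suc_eq_le le_Suc_eq\<close>)
    then show ?thesis
      using dim_krylov_le[of "Suc (Suc k)" M "r 0"] by (simp add: K_def lessThan_Suc_atMost)
  next
    case True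
    (* r 0 lies in the image of K (Suc k), so the generator r 0 adds nothing to that image. *)
    have "r 0 = M *v (- x)"
      using rx True by (simp add: linear_neg[OF matrix_vector_mul_linear] eq_neg_iff_add_eq_0 add.commute)
    moreover have "- x \<in> K (Suc k)"
      using x unfolding K_def by (rule subspace_neg[OF subspace_krylov])
    ultimately have "r 0 \<in> (*v) M ` K (Suc k)"
      by blast
    then have "K (Suc (Suc k)) = span ((*v) M ` K (Suc k))"
      unfolding K_def krylov_Suc[of "Suc k"] by (simp add: insert_absorb)
    then have "dim (K (Suc (Suc k))) \<le> dim (K (Suc k))"
      by (simp add: dim_image_le)
    also have "\<dots> = dim (r ` {..k})"
      unfolding IH[symmetric] by (rule dim_span)
    also have "\<dots> \<le> dim (r ` {..Suc k})"
      by (rule dim_subset) auto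
    finally show ?thesis .
  qed
  show ?case
    using subspace_dim_equal[OF subspace_span _ sub] dims
    by (simp add: K_def subspace_krylov)
qed

section \<open>The iteration without active bounds\<close>

lemma basis_col_in_span: "1 \<le> j \<Longrightarrow> j \<le> k \<Longrightarrow> basis_col r j \<in> span (r ` {..<k})"
  unfolding basis_col_def by (intro span_scale span_base imageI) auto

lemma cols_mult_basis_col_in_span: "cols_mult k (basis_col r) y \<in> span (r ` {..<k})"
  unfolding cols_mult_def by (intro span_sum span_scale basis_col_in_span) auto

lemma KKT_inactive_multipliers_eq_0:
  assumes "projected_KKT A b l u k v y lam mu" and "\<not> bound_active l u k v y"
  shows "lam = 0" and "mu = 0"
  using assms unfolding projected_KKT_def bound_active_def by (auto simp: vec_eq_iff) metis

lemma resqpass_inactive_residual_form: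
  assumes "resqpass A b l u x y lam mu r" and "k \<ge> 1" and "iteration_defined r k"
    and "\<not> bound_active l u k (basis_col r) (y k)"
  shows "\<exists>z \<in> span (r ` {..<k}). r k = (transpose A ** A) *v z + r 0"
proof (rule bexI)
  have KKT: "projected_KKT A b l u k (basis_col r) (y k) (lam k) (mu k)"
    using assms unfolding resqpass_def by blast
  show "r k = (transpose A ** A) *v x k + r 0"
    using assms KKT_inactive_multipliers_eq_0[OF KKT assms(4)] unfolding resqpass_def
    by (simp add: matrix_vector_mult_diff_distrib matrix_vector_mul_assoc)
  show "x k \<in> span (r ` {..<k})"
    using assms cols_mult_basis_col_in_span[of k r "y k"] unfolding resqpass_def by simp
qed

text \<open>
  With vanishing multipliers, stationarity reads \<open>V\<^sub>k\<^sup>T r\<^sub>k = 0\<close>, and the columns of \<open>V\<^sub>k\<close> are nonzero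
  multiples of the earlier residuals.
\<close>

lemma resqpass_inactive_residual_orthogonal:
  assumes "resqpass A b l u x y lam mu r" and "i < k" and "iteration_defined r k"
    and "\<not> bound_active l u k (basis_col r) (y k)"
  shows "r i \<bullet> r k = 0"
proof -
  have k: "k \<ge> 1" using \<open>i < k\<close> by simp
  then have KKT: "projected_KKT A b l u k (basis_col r) (y k) (lam k) (mu k)"
    using assms unfolding resqpass_def by blast
  note mult = KKT_inactive_multipliers_eq_0[OF KKT assms(4)]
  have "r k = transpose A *v (A *v cols_mult k (basis_col r) (y k) - b)"
    using assms k mult unfolding resqpass_def by simp
  moreover have "Suc i \<in> {1..k}"
    using \<open>i < k\<close> by simp
  ultimately have "basis_col r (Suc i) \<bullet> r k = 0"
    using KKT mult unfolding projected_KKT_def cols_transpose_mult_def by force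
  then show ?thesis
    using assms(2,3) by (simp add: basis_col_def iteration_defined_def)
qed

theorem lemma2p5:
  fixes A :: "real ^ 'n ^ 'm" and b :: "real ^ 'm" and l u :: "real ^ 'n"
    and x lam mu r :: "nat \<Rightarrow> real ^ 'n" and y :: "nat \<Rightarrow> nat \<Rightarrow> real"
  assumes "l \<le> 0" and "0 \<le> u"
    and "resqpass A b l u x y lam mu r"
    and "\<And>k. k \<ge> 1 \<Longrightarrow> iteration_defined r k \<Longrightarrow> \<not> bound_active l u k (basis_col r) (y k)"
  shows "\<forall>k. iteration_defined r k \<longrightarrow>
           span (r ` {..k}) = krylov (k + 1) (transpose A ** A) (r 0)"
proof (intro allI impI)
  fix k assume "iteration_defined r k"
  then have "span (r ` {..k}) = krylov (Suc k) (transpose A ** A) (r 0)"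
  proof (rule span_orthogonal_residuals_eq_krylov[rotated 2])
    fix k :: nat assume "k \<ge> 1" "iteration_defined r k"
    then show "\<exists>z \<in> span (r ` {..<k}). r k = (transpose A ** A) *v z + r 0"
      by (intro resqpass_inactive_residual_form[OF assms(3)] assms(4))
  next
    fix i k :: nat assume "i < k" "iteration_defined r k"
    then show "r i \<bullet> r k = 0"
      by (intro resqpass_inactive_residual_orthogonal[OF assms(3)] assms(4)) auto
  qed
  then show "span (r ` {..k}) = krylov (k + 1) (transpose A ** A) (r 0)"
    by simp
qed

end
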